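(* For every $n\ge2$, the number $poa_n$ of gates in the circuit produced by the Palindromic Optimization Algorithm for an arbitrary $2^n\times2^n$ unitary matrix (counted after cancelling the overlaps between successive palindromic subcircuits) is $$poa_n=\frac{7}{3}\,2^{2n-1}-7\cdot2^{n-1}+\frac{10}{3}.$$
   Context: Indices (rows, columns, basis states) run over $0,1,\ldots,2^n-1$ and are identified with their $n$-bit binary expansions. Gates: an $(n-1)$-controlled gate $\Lambda_{n-1}(S)$ applies the single-qubit gate $S$ to one target bit, conditional on the other $n-1$ bits having prescribed values. Two $\Lambda_{n-1}(X)$ gates ($X$ = NOT) are the same iff they have the same target and the same prescribed values of the other bits; each is self-inverting. $GrayCode(c,r)$ is the sequence $g_1=c,g_2,\ldots,g_m=r$ in which $g_{i+1}$ is obtained from $g_i$ by flipping the rightmost (least significant) bit in which $g_i$ differs from $r$. For $c<r$ the palindromic subcircuit $PS(c,r)$ is $$X_1X_2\ldots X_{m-2}\,\beta\,X_{m-2}\ldots X_2X_1,$$ where $X_i$ is the $\Lambda_{n-1}(X)$ gate whose target is the bit in which $g_i$ and $g_{i+1}$ differ, conditional on the other bits being as in $g_i$, and $\beta$ is one generic gate $\Lambda_{n-1}(\tilde V)$ (different for each pair $(r,c)$, never cancelling), where $\tilde V$ is the $2\times 2$ component of the two-level matrix produced for the pair $(r,c)$ by the two-level decomposition of the given unitary matrix. One such gate is always output and counted for each pair. Overlap: for consecutive subcircuits $\alpha_1\beta_1\alpha_1^R$ and $\alpha_2\beta_2\alpha_2^R$ ($\alpha^R$ denotes reversal), the overlap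 is the longest prefix $\gamma$ of $\alpha_2$ such that $\gamma^R$ is a suffix of $\alpha_1^R$, i.e. the longest common prefix of $\alpha_1$ and $\alpha_2$; the $2\,length(\gamma)$ gates of $\gamma^R\gamma$ cancel and are removed. Palindromic Optimization Algorithm (POA): its circuit is the concatenation of the subcircuits $PS(c,r)$, for all $0\le c<r\le2^n-1$, taken column by column $c=0,1,\ldots,2^n-2$, with the rows $r$ in column $c$ in the order given by the sequence $R_n^c$, where $R_2^0=(1,2,3)$, $R_2^1=(2,3)$, $R_2^2=(3)$, $R_2^3=()$ and, for $m\ge3$ and $0\le c\le2^{m-1}-1$, $$R_m^{2c}=\bigl(2R_{m-1}^c,\;2c+1,\;2R_{m-1}^c+1\bigr),\qquad R_m^{2c+1}=\bigl(2R_{m-1}^c,\;2R_{m-1}^c+1\bigr)$$ (concatenation of sequences; $2R$ and $2R+1$ mean the map $x\mapsto2x$, resp. $x\mapsto2x+1$, applied to each term). $poa_n$ is the total number of gates remaining in this concatenation after the overlaps of all consecutive pairs (within columns and between consecutive columns) are cancelled. *)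

theory Defs
  imports Complex_Main "HOL-Library.Sublist" "Jordan_Normal_Form.Schur_Decomposition"
begin

section \<open>Gates on \<open>n\<close> bits\<close>

text \<open>Basis states are naturals below \<open>2 ^ n\<close>; bit 0 is the rightmost (least significant) one.
  A gate records its target and the prescribed values of the other bits. The generic gates form a
  separate constructor and carry their pair \<open>(c, r)\<close>: gates of different pairs are different,
  and none equals a controlled NOT, even if the \<open>2 \<times> 2\<close> matrices happen to agree.\<close>

datatype gate =
    CtrlNot nat "nat \<rightharpoonup> bool"
  | CtrlGeneric "nat \<times> nat" nat "nat \<rightharpoonup> bool" "complex mat"

definition prescribed :: "nat \<Rightarrow> nat \<Rightarrow> nat \<Rightarrow> (nat \<rightharpoonup> bool)" where
  "prescribed n t g = (\<lambda>j. if j < n \<and> j \<noteq> t then Some (bit g j) else None)"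

section \<open>Gray codes and palindromic subcircuits\<close>

definition low_diff :: "nat \<Rightarrow> nat \<Rightarrow> nat" where
  "low_diff a b = (LEAST j. bit a j \<noteq> bit b j)"

lemma low_diff_bit:
  assumes "a \<noteq> b"
  shows "bit a (low_diff a b) \<noteq> bit b (low_diff a b)"
proof -
  obtain j where "bit a j \<noteq> bit b j"
    using assms bit_eq_iff by blast
  then show ?thesis
    unfolding low_diff_def by (rule LeastI)
qed

lemma finite_bits_nat: "finite {j. bit (a::nat) j}"
proof (rule finite_subset)
  show "{j. bit a j} \<subseteq> {..<a}"
  proof
    fix j assume "j \<in> {j. bit a j}"
    then have "odd (a div 2 ^ j)"
      by (simp add: bit_iff_odd)
    then have "a div 2 ^ j \<noteq> 0"
      by (metis even_zero)
    then have "2 ^ j \<le> a"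
      by (metis div_less not_le)
    then show "j \<in> {..<a}"
      using order.strict_trans2[OF less_exp] by simp
  qed
qed simp

function gray_code :: "nat \<Rightarrow> nat \<Rightarrow> nat list" where
  "gray_code c r =
     (if c = r then [c] else c # gray_code (flip_bit (low_diff c r) c) r)"
  by auto
termination
proof (relation "measure (\<lambda>(c, r). card {j. bit c j \<noteq> bit r j})")
  fix c r :: nat
  assume ne: "c \<noteq> r"
  let ?D = "{j. bit c j \<noteq> bit r j}"
  have fin: "finite ?D"
    by (rule finite_subset[of _ "{j. bit c j} \<union> {j. bit r j}"]) (auto simp: finite_bits_nat)
  have "{j. bit (flip_bit (low_diff c r) c) j \<noteq> bit r j} \<subset> ?D"
    using low_diff_bit[OF ne] by (auto simp: bit_flip_bit_iff)
  then have "card {j. bit (flip_bit (low_diff c r) c) j \<noteq> bit r j} < card ?D"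
    using fin by (rule psubset_card_mono[rotated])
  then show "((flip_bit (low_diff c r) c, r), (c, r))
      \<in> measure (\<lambda>(c, r). card {j. bit c j \<noteq> bit r j})"
    by simp
qed simp

declare gray_code.simps [simp del]

definition step_target :: "nat list \<Rightarrow> nat \<Rightarrow> nat" where
  "step_target g i = low_diff (g ! i) (g ! Suc i)"

definition ps_prefix :: "nat \<Rightarrow> nat \<Rightarrow> nat \<Rightarrow> gate list" where
  "ps_prefix n c r =
     (let g = gray_code c r in
      map (\<lambda>i. CtrlNot (step_target g i) (prescribed n (step_target g i) (g ! i)))
        [0..<length g - 2])"

text \<open>The last flip sets the leading bit in which \<open>c < r\<close> differ, so it goes from 0 to 1 and the
  matrix needs no change of basis order.\<close>

definition ps_centre :: "nat \<Rightarrow> (nat \<Rightarrow> nat \<Rightarrow> complex mat) \<Rightarrow> nat \<Rightarrow> nat \<Rightarrow> gate" where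
  "ps_centre n V c r =
     (let g = gray_code c r; i = length g - 2; t = step_target g i in
      CtrlGeneric (c, r) t (prescribed n t (g ! i)) (V c r))"

section \<open>The order of the pairs\<close>

fun row_order :: "nat \<Rightarrow> nat \<Rightarrow> nat list" where
  "row_order 0 c = []"
| "row_order (Suc 0) c = []"
| "row_order (Suc (Suc 0)) c =
     (if c = 0 then [1, 2, 3] else if c = 1 then [2, 3] else if c = 2 then [3] else [])"
| "row_order (Suc (Suc (Suc k))) c =
     (let R = row_order (Suc (Suc k)) (c div 2) in
      map (\<lambda>x. 2 * x) R @ (if even c then [c + 1] else []) @ map (\<lambda>x. 2 * x + 1) R)"

definition poa_pairs :: "nat \<Rightarrow> (nat \<times> nat) list" where
  "poa_pairs n = concat (map (\<lambda>c. map (Pair c) (row_order n c)) [0..<2 ^ n - 1])"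

section \<open>Two-level decomposition\<close>

definition unitary_mat :: "nat \<Rightarrow> complex mat \<Rightarrow> bool" where
  "unitary_mat N U \<longleftrightarrow>
     U \<in> carrier_mat N N \<and> mat_adjoint U * U = 1\<^sub>m N \<and> U * mat_adjoint U = 1\<^sub>m N"

definition two_level :: "nat \<Rightarrow> nat \<Rightarrow> nat \<Rightarrow> complex mat \<Rightarrow> complex mat" where
  "two_level N c r S = mat N N (\<lambda>(i, j).
     if i \<in> {c, r} \<and> j \<in> {c, r}
     then S $$ (if i = c then 0 else 1, if j = c then 0 else 1)
     else if i = j then 1 else 0)"

text \<open>What is left of \<open>U\<close> after the two-level factors of the listed pairs have been split off
  from the left.\<close>

definition residual ::
  "nat \<Rightarrow> (nat \<Rightarrow> nat \<Rightarrow> complex mat) \<Rightarrow> (nat \<times> nat) list \<Rightarrow> complex mat \<Rightarrow> complex mat" where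
  "residual N V ps U =
     fold (\<lambda>(c, r) M. mat_adjoint (two_level N c r (V c r)) * M) ps U"

text \<open>The factor of \<open>(c, r)\<close> eliminates the entry in row \<open>r\<close> and column \<open>c\<close>; finally nothing but
  the identity is left, i.e. \<open>U\<close> is the product, in the order of \<open>poa_pairs\<close>, of its two-level
  factors. These are not unique (phases, and entries that are already zero), so this is a
  predicate.\<close>

definition two_level_decomposition ::
  "nat \<Rightarrow> complex mat \<Rightarrow> (nat \<Rightarrow> nat \<Rightarrow> complex mat) \<Rightarrow> bool" where
  "two_level_decomposition n U V \<longleftrightarrow>
     (\<forall>(c, r) \<in> set (poa_pairs n). unitary_mat 2 (V c r)) \<and>
     (\<forall>k < length (poa_pairs n). case poa_pairs n ! k of (c, r) \<Rightarrow>
        residual (2 ^ n) V (take (Suc k) (poa_pairs n)) U $$ (r, c) = 0) \<and>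
     residual (2 ^ n) V (poa_pairs n) U = 1\<^sub>m (2 ^ n)"

section \<open>Cancellation of overlaps\<close>

text \<open>A pair \<open>(\<alpha>, \<beta>)\<close> stands for the palindromic subcircuit \<open>\<alpha> @ [\<beta>] @ rev \<alpha>\<close>. The argument \<open>k\<close>
  is the number of gates at the start of the first subcircuit that have been cancelled against
  its predecessor; cancelling the overlap \<open>\<gamma>\<close> with the successor removes the suffix \<open>rev \<gamma>\<close> of
  \<open>rev \<alpha>\<close>, which leaves \<open>rev (drop (length \<gamma>) \<alpha>)\<close>.\<close>

fun cancel_overlaps :: "nat \<Rightarrow> ('g list \<times> 'g) list \<Rightarrow> 'g list" where
  "cancel_overlaps k [] = []"
| "cancel_overlaps k [(\<alpha>, \<beta>)] = drop k \<alpha> @ [\<beta>] @ rev \<alpha>"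
| "cancel_overlaps k ((\<alpha>, \<beta>) # (\<alpha>', \<beta>') # ps) =
     (let l = length (longest_common_prefix \<alpha> \<alpha>') in
      drop k \<alpha> @ [\<beta>] @ rev (drop l \<alpha>) @ cancel_overlaps l ((\<alpha>', \<beta>') # ps))"

definition poa_circuit :: "nat \<Rightarrow> (nat \<Rightarrow> nat \<Rightarrow> complex mat) \<Rightarrow> gate list" where
  "poa_circuit n V =
     cancel_overlaps 0 (map (\<lambda>(c, r). (ps_prefix n c r, ps_centre n V c r)) (poa_pairs n))"

end

theory Submission
  imports Defs
begin

text \<open>Passing from \<open>n\<close> to \<open>n + 1\<close> bits, the subcircuits of column \<open>c\<close> are turned into those of the
  columns \<open>2 c\<close> and \<open>2 c + 1\<close>: each row \<open>r\<close> of column \<open>c\<close> occurs twice in both, once as the same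
  prefix with a fixed lowest bit, and once as such a prefix preceded by a NOT on the lowest bit. The
  latter NOT is the same gate for all rows of both columns, so it is counted once per column: the
  cost \<open>C\<close> of a nonempty column becomes \<open>2 C + 3\<close> and \<open>2 C + 2\<close>, respectively. Moreover this NOT is
  exactly what cancels between columns \<open>2 c\<close> and \<open>2 c + 1\<close>, whereas nothing cancels between columns
  \<open>2 c + 1\<close> and \<open>2 c + 2\<close> because their prescribed lowest bits differ.\<close>

section \<open>Cost of a sequence of palindromes\<close>

abbreviation overlap :: "'g list \<Rightarrow> 'g list \<Rightarrow> nat" where
  "overlap xs ys \<equiv> length (longest_common_prefix xs ys)"

text \<open>Unlike \<open>cancel_overlaps\<close>, it carries no offset, so concatenation needs a
  correction only at the junction; integers keep the subtraction exact.\<close>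

fun net_cost :: "'g list list \<Rightarrow> int" where
  "net_cost [] = 0"
| "net_cost [x] = 2 * int (length x) + 1"
| "net_cost (x # y # xs) =
     2 * int (length x) + 1 - 2 * int (overlap x y) + net_cost (y # xs)"

lemma overlap_le_length: "overlap xs ys \<le> length xs" "overlap xs ys \<le> length ys"
  using longest_common_prefix_prefix1 longest_common_prefix_prefix2 prefix_length_le by blast+

text \<open>The offset \<open>k\<close> shortens only the first palindrome. Each overlap is removed
  twice: as a suffix of one palindrome and, through the offset, as a prefix of the next.\<close>

lemma length_cancel_overlaps:
  assumes "ps \<noteq> [] \<Longrightarrow> k \<le> length (fst (hd ps))" "ps = [] \<Longrightarrow> k = 0"
  shows "int (length (cancel_overlaps k ps)) = net_cost (map fst ps) - int k"
  using assms
proof (induction k ps rule: cancel_overlaps.induct)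
  case (3 k \<alpha> \<beta> \<alpha>' \<beta>' ps)
  let ?l = "overlap \<alpha> \<alpha>'"
  have "int (length (cancel_overlaps ?l ((\<alpha>', \<beta>') # ps)))
      = net_cost (map fst ((\<alpha>', \<beta>') # ps)) - int ?l"
    using "3.IH"[OF refl] overlap_le_length(2)[of \<alpha> \<alpha>'] by simp
  moreover have "k \<le> length \<alpha>"
    using "3.prems" by simp
  ultimately show ?case
    using overlap_le_length(1)[of \<alpha> \<alpha>'] by (simp add: Let_def of_nat_diff)
qed auto

lemma net_cost_append:
  assumes "xs \<noteq> []" "ys \<noteq> []"
  shows "net_cost (xs @ ys) = net_cost xs + net_cost ys - 2 * int (overlap (last xs) (hd ys))"
  using assms
proof (induction xs rule: net_cost.induct)
  case (2 x)
  then show ?case by (cases ys) auto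
qed auto

lemma net_cost_Nil_Cons: "net_cost ([] # xs) = net_cost xs + 1"
  by (cases xs) auto

lemma longest_common_prefix_map:
  assumes "inj f"
  shows "longest_common_prefix (map f xs) (map f ys) = map f (longest_common_prefix xs ys)"
  by (induction xs ys rule: longest_common_prefix.induct) (auto simp: inj_eq[OF assms])

lemma net_cost_map:
  assumes "inj f"
  shows "net_cost (map (map f) xs) = net_cost xs"
  by (induction xs rule: net_cost.induct) (auto simp: longest_common_prefix_map[OF assms])

text \<open>Each of \<open>m\<close> palindromes gains two gates, and each of the
  \<open>m - 1\<close> overlaps grows by one, so \<open>2 * m - 2 * (m - 1) = 2\<close>
  remains.\<close>

lemma net_cost_Cons:
  assumes "xs \<noteq> []"
  shows "net_cost (map ((#) x) xs) = net_cost xs + 2"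
  using assms by (induction xs rule: net_cost.induct) auto

section \<open>Prefixes of palindromic subcircuits\<close>

definition cnot :: "nat \<Rightarrow> nat \<Rightarrow> nat \<Rightarrow> gate" where
  "cnot n g t = CtrlNot t (prescribed n t g)"

lemma low_diff_flip_bit: "low_diff c (flip_bit j c) = j"
  unfolding low_diff_def by (rule Least_equality) (auto simp: bit_flip_bit_iff split: if_splits)

text \<open>Replaces list indices by recursion along the Gray code. The last flip belongs to the
  centre, so the prefix stops once a single flip reaches \<open>r\<close>.\<close>

lemma ps_prefix_rec:
  "ps_prefix n c r =
     (if c = r \<or> flip_bit (low_diff c r) c = r then []
      else cnot n c (low_diff c r) # ps_prefix n (flip_bit (low_diff c r) c) r)"
proof (cases "c = r \<or> flip_bit (low_diff c r) c = r")
  case True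
  then show ?thesis
    by (auto simp: ps_prefix_def gray_code.simps[of c r] gray_code.simps[of r r] Let_def)
next
  case False
  define c' where "c' = flip_bit (low_diff c r) c"
  obtain gs where gs: "gray_code c' r = c' # gs" "gs \<noteq> []"
    using False by (auto simp: gray_code.simps[of c' r] c'_def gray_code.simps[of _ r])
  have g: "gray_code c r = c # c' # gs"
    using False gs by (auto simp: gray_code.simps[of c r] c'_def)
  \<comment> \<open>\<open>gray_code c r\<close> has two entries more than \<open>gs\<close>,
    \<open>gray_code c' r\<close> one more: after step 0, the steps are those from
    \<open>c'\<close>, shifted by one.\<close>
  have "[0..<length gs] = 0 # map Suc [0..<length gs - 1]"
    using gs(2) by (cases gs) (simp_all add: upt_conv_Cons map_Suc_upt del: upt_Suc)
  then show ?thesis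
    using False gs(1) g
    by (simp add: ps_prefix_def Let_def step_target_def cnot_def low_diff_flip_bit flip: c'_def)
      (simp add: c'_def low_diff_flip_bit)
qed

fun lift_gate :: "bool \<Rightarrow> gate \<Rightarrow> gate" where
  "lift_gate b (CtrlNot t p) = CtrlNot (Suc t) (case_nat (Some b) p)"
| "lift_gate b (CtrlGeneric q t p A) = CtrlGeneric q (Suc t) (case_nat (Some b) p) A"

lemma case_nat_eq_iff: "case_nat x f = case_nat y g \<longleftrightarrow> x = y \<and> f = g"
  by (metis ext nat.case)

lemma lift_gate_eq_iff: "lift_gate b g = lift_gate b' g' \<longleftrightarrow> b = b' \<and> g = g'"
  by (cases g; cases g') (auto simp: case_nat_eq_iff)

lemma inj_lift_gate: "inj (lift_gate b)"
  by (auto simp: inj_def lift_gate_eq_iff)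

lemma lift_gate_neq_cnot_0: "lift_gate b g \<noteq> cnot n c 0" "cnot n c 0 \<noteq> lift_gate b g"
  by (cases g; simp add: cnot_def)+

lemma bit_double_Suc: "bit (2 * a + of_bool b) (Suc j) = bit (a::nat) j"
  by (simp add: bit_Suc)

lemma bit_double_0: "bit (2 * a + of_bool b :: nat) 0 = b"
  by (simp add: bit_0)

lemma low_diff_double_Suc:
  assumes "c \<noteq> r"
  shows "low_diff (2 * c + of_bool b) (2 * r + of_bool b) = Suc (low_diff c r)"
proof -
  have "(LEAST j. bit (2 * c + of_bool b) j \<noteq> bit (2 * r + of_bool b) j)
      = Suc (LEAST j. bit (2 * c + of_bool b) (Suc j) \<noteq> bit (2 * r + of_bool b) (Suc j))"
  proof (rule Least_Suc)
    show "bit (2 * c + of_bool b) (Suc (low_diff c r)) \<noteq> bit (2 * r + of_bool b) (Suc (low_diff c r))"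
      using low_diff_bit[OF assms] by (simp only: bit_double_Suc) simp
    show "\<not> bit (2 * c + of_bool b) 0 \<noteq> bit (2 * r + of_bool b) 0"
      by (simp only: bit_double_0)
  qed
  then show ?thesis
    by (simp only: low_diff_def bit_double_Suc)
qed

lemma low_diff_double_0: "low_diff (2 * c + of_bool b) (2 * r + of_bool (\<not> b)) = 0"
  unfolding low_diff_def by (rule Least_eq_0) (simp only: bit_double_0; simp)

lemma flip_bit_double_Suc:
  "flip_bit (Suc j) (2 * c + of_bool b) = 2 * flip_bit j c + (of_bool b :: nat)"
proof (rule bit_eqI)
  fix i
  show "bit (flip_bit (Suc j) (2 * c + of_bool b)) i = bit (2 * flip_bit j c + (of_bool b :: nat)) i"
    by (cases i) (simp_all only: bit_flip_bit_iff bit_double_0 bit_double_Suc, auto)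
qed

lemma flip_bit_double_0:
  "flip_bit 0 (2 * c + of_bool b) = 2 * c + (of_bool (\<not> b) :: nat)"
proof (rule bit_eqI)
  fix i
  show "bit (flip_bit 0 (2 * c + of_bool b)) i = bit (2 * c + (of_bool (\<not> b) :: nat)) i"
    by (cases i) (simp_all only: bit_flip_bit_iff bit_double_0 bit_double_Suc, auto)
qed

lemma cnot_double_Suc:
  "cnot (Suc n) (2 * c + of_bool b) (Suc t) = lift_gate b (cnot n c t)"
proof -
  have "prescribed (Suc n) (Suc t) (2 * c + of_bool b) = case_nat (Some b) (prescribed n t c)"
  proof
    fix j
    show "prescribed (Suc n) (Suc t) (2 * c + of_bool b) j = case_nat (Some b) (prescribed n t c) j"
      by (cases j) (simp_all only: prescribed_def bit_double_0 bit_double_Suc, auto)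
  qed
  then show ?thesis
    by (simp only: cnot_def lift_gate.simps)
qed

text \<open>The target bit itself is not prescribed, so columns \<open>2 * c\<close> and
  \<open>2 * c + 1\<close> share this gate.\<close>

lemma cnot_double_0: "cnot n (2 * c + of_bool b) 0 = cnot n (2 * c) 0"
proof -
  have "prescribed n 0 (2 * c + of_bool b) = prescribed n 0 (2 * c + of_bool False)"
  proof
    fix j
    show "prescribed n 0 (2 * c + of_bool b) j = prescribed n 0 (2 * c + of_bool False) j"
      by (cases j) (simp_all only: prescribed_def bit_double_0 bit_double_Suc, auto)
  qed
  then show ?thesis
    by (simp add: cnot_def)
qed

text \<open>Equal lowest bits are never flipped, so the Gray code runs on the upper bits
  alone.\<close>

lemma ps_prefix_same_bit:
  "ps_prefix (Suc n) (2 * c + of_bool b) (2 * r + of_bool b) = map (lift_gate b) (ps_prefix n c r)"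
proof (induction c r rule: gray_code.induct)
  case (1 c r)
  have eq_iff: "2 * x + of_bool b = 2 * y + (of_bool b :: nat) \<longleftrightarrow> x = y" for x y
    by simp
  show ?case
  proof (cases "c = r")
    case True
    then show ?thesis by (simp add: ps_prefix_rec[of _ x x for x])
  next
    case False
    show ?thesis
      unfolding ps_prefix_rec[of "Suc n" "2 * c + of_bool b"] ps_prefix_rec[of n c]
        low_diff_double_Suc[OF False] flip_bit_double_Suc cnot_double_Suc eq_iff
        "1.IH"[OF False]
      by simp
  qed
qed

text \<open>The lowest bit is flipped first, which leads back to equal lowest bits. If
  \<open>c = r\<close>, this flip is also the last one and hence the centre.\<close>

lemma ps_prefix_other_bit:
  "ps_prefix (Suc n) (2 * c + of_bool b) (2 * r + of_bool (\<not> b)) =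
     (if c = r then [] else cnot (Suc n) (2 * c) 0 # map (lift_gate (\<not> b)) (ps_prefix n c r))"
proof -
  have "2 * c + of_bool b \<noteq> 2 * r + of_bool (\<not> b)"
    by (cases b; simp; presburger)
  then show ?thesis
    by (subst ps_prefix_rec)
      (simp only: low_diff_double_0 flip_bit_double_0 cnot_double_0 ps_prefix_same_bit, simp)
qed

lemmas ps_prefix_simps =
  ps_prefix_same_bit[where b = False, simplified]
  ps_prefix_same_bit[where b = True, simplified]
  ps_prefix_other_bit[where b = False, simplified]
  ps_prefix_other_bit[where b = True, simplified]

lemma overlap_lift_gate_neq:
  assumes "b \<noteq> b'"
  shows "longest_common_prefix (map (lift_gate b) xs) (map (lift_gate b') ys) = []"
  using assms by (cases xs; cases ys) (auto simp: lift_gate_eq_iff)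

lemma overlap_lift_gate_cnot_0:
  "longest_common_prefix (map (lift_gate b) xs) (cnot n c 0 # ys) = []"
  "longest_common_prefix (cnot n c 0 # ys) (map (lift_gate b) xs) = []"
  by (cases xs; simp add: lift_gate_neq_cnot_0)+

section \<open>Columns\<close>

lemma row_order_Suc:
  assumes "n \<ge> 2"
  shows "row_order (Suc n) c =
    map (\<lambda>x. 2 * x) (row_order n (c div 2)) @ (if even c then [c + 1] else []) @
    map (\<lambda>x. 2 * x + 1) (row_order n (c div 2))"
  using assms by (cases n rule: row_order.cases[of "(n, c)" for n, simplified]) (auto simp: Let_def)

text \<open>Rules out the exceptional case \<open>c = r\<close> of
  \<open>ps_prefix_other_bit\<close> in the column formulas.\<close>

lemma notin_row_order: "c \<notin> set (row_order n c)"
  by (induction n c rule: row_order.induct) (auto simp: Let_def)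

lemma row_order_eq_Nil_iff:
  assumes "n \<ge> 2" "c < 2 ^ n"
  shows "row_order n c = [] \<longleftrightarrow> Suc c = 2 ^ n"
  using assms
proof (induction n arbitrary: c rule: nat_induct_at_least)
  case base
  then have "c \<in> {0, 1, 2, 3}"
    by auto
  then show ?case by (auto simp: row_order.simps(3)[folded numeral_2_eq_2])
next
  case (Suc n)
  then have "c div 2 < 2 ^ n"
    by auto
  then have "row_order (Suc n) c = [] \<longleftrightarrow> Suc (c div 2) = 2 ^ n \<and> odd c"
    using Suc by (simp add: row_order_Suc)
  also have "\<dots> \<longleftrightarrow> Suc c = 2 ^ Suc n"
    unfolding power_Suc by presburger
  finally show ?case .
qed

definition column :: "nat \<Rightarrow> nat \<Rightarrow> gate list list" where
  "column n c = map (ps_prefix n c) (row_order n c)"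

text \<open>The middle \<open>[]\<close> is row \<open>2 * c + 1\<close>, a single flip away from
  \<open>2 * c\<close>.\<close>

lemma column_double:
  assumes "n \<ge> 2"
  shows "column (Suc n) (2 * c) =
    map (map (lift_gate False)) (column n c) @ [[]] @
    map ((#) (cnot (Suc n) (2 * c) 0)) (map (map (lift_gate True)) (column n c))"
  using notin_row_order[of c n]
  by (auto simp: column_def row_order_Suc[OF assms] ps_prefix_simps)

lemma column_double_Suc:
  assumes "n \<ge> 2"
  shows "column (Suc n) (Suc (2 * c)) =
    map ((#) (cnot (Suc n) (2 * c) 0)) (map (map (lift_gate False)) (column n c)) @
    map (map (lift_gate True)) (column n c)"
  using notin_row_order[of c n]
  by (auto simp: column_def row_order_Suc[OF assms] ps_prefix_simps)

lemma column_eq_Nil_iff: "n \<ge> 2 \<Longrightarrow> c < 2 ^ n \<Longrightarrow> column n c = [] \<longleftrightarrow> Suc c = 2 ^ n"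
  by (simp add: column_def row_order_eq_Nil_iff)

text \<open>The empty middle prefix overlaps nothing, so for a nonempty column of cost
  \<open>C\<close> the three blocks cost \<open>C\<close>, 1 and \<open>C + 2\<close>.\<close>

lemma net_cost_column_double:
  assumes "n \<ge> 2"
  shows "net_cost (column (Suc n) (2 * c)) =
    (if column n c = [] then 1 else 2 * net_cost (column n c) + 3)"
  by (simp add: column_double[OF assms] net_cost_append net_cost_Cons net_cost_map net_cost_Nil_Cons inj_lift_gate
      del: map_map)

text \<open>Only prefixes of the first block start with a NOT on bit 0, so nothing cancels between
  the blocks, which cost \<open>C + 2\<close> and \<open>C\<close>.\<close>

lemma net_cost_column_double_Suc:
  assumes "n \<ge> 2"
  shows "net_cost (column (Suc n) (Suc (2 * c))) =
    (if column n c = [] then 0 else 2 * net_cost (column n c) + 2)"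
  by (simp add: column_double_Suc[OF assms] net_cost_append net_cost_Cons net_cost_map inj_lift_gate
      last_map hd_map overlap_lift_gate_cnot_0 del: map_map)

lemma ps_prefix_2:
  "ps_prefix 2 0 (Suc 0) = []" "ps_prefix 2 0 2 = []" "ps_prefix 2 0 3 = [cnot 2 0 0]"
  "ps_prefix 2 (Suc 0) 2 = [cnot 2 0 0]" "ps_prefix 2 (Suc 0) 3 = []" "ps_prefix 2 2 3 = []"
proof -
  have "low_diff 0 (Suc 0) = 0"
    using low_diff_double_0[of 0 False 0] by simp
  moreover have "flip_bit 0 0 = Suc 0"
    using flip_bit_double_0[of 0 False] by simp
  \<comment> \<open>All six two-bit prefixes follow from this one-bit value by the doubling
    rules.\<close>
  ultimately have "ps_prefix 1 0 (Suc 0) = []"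
    by (subst ps_prefix_rec) simp
  then show
    "ps_prefix 2 0 (Suc 0) = []" "ps_prefix 2 0 2 = []" "ps_prefix 2 0 3 = [cnot 2 0 0]"
    "ps_prefix 2 (Suc 0) 2 = [cnot 2 0 0]" "ps_prefix 2 (Suc 0) 3 = []" "ps_prefix 2 2 3 = []"
    using ps_prefix_simps(3)[of 1 0 0] ps_prefix_simps(1)[of 1 0 1] ps_prefix_simps(3)[of 1 0 1]
      ps_prefix_simps(4)[of 1 0 1] ps_prefix_simps(2)[of 1 0 1] ps_prefix_simps(3)[of 1 1 1]
    by (simp_all add: numeral_2_eq_2 numeral_3_eq_3)
qed

lemma column_2:
  "column 2 0 = [[], [], [cnot 2 0 0]]" "column 2 (Suc 0) = [[cnot 2 0 0], []]" "column 2 2 = [[]]"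
  by (simp_all add: column_def ps_prefix_2 numeral_2_eq_2[symmetric]
      row_order.simps(3)[folded numeral_2_eq_2])

text \<open>Both adjacent prefixes start with the shared NOT on bit 0; any gates after it differ in
  the prescribed lowest bit.\<close>

lemma overlap_columns_even:
  assumes "n \<ge> 2" "Suc (2 * c) < 2 ^ n - 1"
  shows "overlap (last (column n (2 * c))) (hd (column n (Suc (2 * c)))) = 1"
proof (cases "n = 2")
  case True
  then have "c = 0"
    using assms by simp
  with True show ?thesis by (simp add: column_2)
next
  case False
  then obtain m where m: "n = Suc m" "m \<ge> 2"
    using assms by (metis Suc_le_D Suc_le_mono le_antisym not_less_eq_eq numeral_2_eq_2)
  have "column m c \<noteq> []"
    using assms m by (simp add: column_eq_Nil_iff)
  then show ?thesis
    by (simp add: m column_double column_double_Suc last_map hd_map overlap_lift_gate_neq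
        del: map_map)
qed

lemma overlap_columns_odd:
  assumes "n \<ge> 2" "Suc (Suc (2 * c)) < 2 ^ n - 1"
  shows "overlap (last (column n (Suc (2 * c)))) (hd (column n (Suc (Suc (2 * c))))) = 0"
proof (cases "n = 2")
  case True
  then have "c = 0"
    using assms by simp
  with True show ?thesis by (simp add: column_2 flip: numeral_2_eq_2)
next
  case False
  then obtain m where m: "n = Suc m" "m \<ge> 2"
    using assms by (metis Suc_le_D Suc_le_mono le_antisym not_less_eq_eq numeral_2_eq_2)
  have "column m c \<noteq> []"
    using assms m by (simp add: column_eq_Nil_iff)
  \<comment> \<open>Column \<open>Suc c\<close> on \<open>m\<close> bits may be the empty last one;
    then column \<open>2 * c + 2\<close> starts with \<open>[]\<close>.\<close>
  then show ?thesis
    using m(2) column_double[of m "Suc c"]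
    by (cases "column m (Suc c) = []")
      (simp_all add: m(1) column_double_Suc last_map hd_map overlap_lift_gate_neq del: map_map)
qed

section \<open>Counting gates\<close>

lemma sum_lessThan_double:
  "(\<Sum>i<2 * m. f i) = (\<Sum>i<m. f (2 * i) + f (Suc (2 * i)) :: 'a :: comm_monoid_add)"
  by (induction m) (simp_all add: ac_simps)

text \<open>The factor 3 keeps the closed form in the integers. It solves the recurrence
  \<open>S' = 4 * S + 5 * (2 ^ n - 1) + 1\<close>.\<close>

lemma sum_net_cost_column:
  assumes "n \<ge> 2"
  shows "3 * (\<Sum>c<2 ^ n - 1. net_cost (column n c)) = 7 * 2 ^ (2 * n - 1) - 15 * 2 ^ (n - 1) + 4"
  using assms
proof (induction n rule: nat_induct_at_least)
  case base
  have "{..<2 ^ 2 - 1 :: nat} = {0, Suc 0, 2}"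
    by auto
  then show ?case
    by (simp add: column_2)
next
  case (Suc n)
  let ?M = "2 ^ n - 1 :: nat"
  let ?S = "\<Sum>c<?M. net_cost (column n c)"
  \<comment> \<open>Pairing the columns leaves over column \<open>2 * ?M\<close>, which arises from
    the empty column \<open>?M\<close> and costs 1.\<close>
  have "2 ^ Suc n - 1 = Suc (2 * ?M)"
    using one_le_power[of "2::nat" n] by (simp del: one_le_power, linarith)
  then have "(\<Sum>c<2 ^ Suc n - 1. net_cost (column (Suc n) c)) =
      (\<Sum>c<?M. net_cost (column (Suc n) (2 * c)) + net_cost (column (Suc n) (Suc (2 * c)))) + 1"
    using Suc.hyps
    by (simp add: sum_lessThan_double net_cost_column_double column_eq_Nil_iff del: power_Suc)
  also have "(\<Sum>c<?M. net_cost (column (Suc n) (2 * c)) + net_cost (column (Suc n) (Suc (2 * c))))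
      = (\<Sum>c<?M. 4 * net_cost (column n c) + 5)"
    using Suc.hyps
    by (intro sum.cong) (auto simp: net_cost_column_double net_cost_column_double_Suc column_eq_Nil_iff)
  also have "\<dots> = 4 * ?S + 5 * int ?M"
    by (simp add: sum.distrib sum_distrib_left)
  finally have "3 * (\<Sum>c<2 ^ Suc n - 1. net_cost (column (Suc n) c)) = 4 * (3 * ?S) + 15 * int ?M + 3"
    by simp
  also have "\<dots> = 7 * 2 ^ (2 * Suc n - 1) - 15 * 2 ^ (Suc n - 1) + 4"
  proof -
    obtain k where "n = Suc k"
      using Suc.hyps by (cases n) auto
    then show ?thesis
      unfolding Suc.IH by (simp add: of_nat_diff)
  qed
  finally show ?case .
qed

text \<open>Only junctions from an even to an odd column cancel, two gates each; the first
  \<open>m\<close> columns have \<open>m div 2\<close> of them.\<close>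

lemma net_cost_concat_columns:
  assumes "n \<ge> 2" "m \<le> 2 ^ n - 1"
  shows "net_cost (concat (map (column n) [0..<m]))
    = (\<Sum>c<m. net_cost (column n c)) - 2 * int (m div 2)"
  using assms(2)
proof (induction m)
  case (Suc m)
  show ?case
  proof (cases m)
    case (Suc k)
    let ?xs = "concat (map (column n) [0..<m])"
    have ne: "column n m \<noteq> []" "column n k \<noteq> []"
      using assms(1) Suc Suc.prems by (auto simp: column_eq_Nil_iff)
    have last: "?xs \<noteq> []" "last ?xs = last (column n k)"
      using ne Suc by auto
    have "overlap (last (column n k)) (hd (column n m)) = Suc m div 2 - m div 2"
    proof (cases "even k")
      case True
      then show ?thesis
        using overlap_columns_even[OF assms(1), of "k div 2"] Suc Suc.prems by auto
    next
      case False
      then show ?thesis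
        using overlap_columns_odd[OF assms(1), of "k div 2"] Suc Suc.prems
        by (auto elim!: oddE)
    qed
    moreover have "m div 2 \<le> Suc m div 2"
      by simp
    ultimately show ?thesis
      using Suc.IH Suc.prems net_cost_append[OF last(1) ne(1)] last(2) by (simp add: of_nat_diff)
  qed simp
qed simp

theorem mainTheorem4:
  fixes n :: nat and U :: "complex mat" and V :: "nat \<Rightarrow> nat \<Rightarrow> complex mat"
  assumes "n \<ge> 2"
    and "unitary_mat (2 ^ n) U"
    and "two_level_decomposition n U V"
  shows "real (length (poa_circuit n V))
           = 7 / 3 * 2 ^ (2 * n - 1) - 7 * 2 ^ (n - 1) + 10 / 3"
proof -
  let ?S = "\<Sum>c<2 ^ n - 1. net_cost (column n c)"
  have "map (\<lambda>(c, r). ps_prefix n c r) (poa_pairs n) = concat (map (column n) [0..<2 ^ n - 1])"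
    by (simp add: poa_pairs_def map_concat column_def[abs_def] comp_def)
  then have "int (length (poa_circuit n V)) = net_cost (concat (map (column n) [0..<2 ^ n - 1]))"
    unfolding poa_circuit_def
    by (subst length_cancel_overlaps) (simp_all add: comp_def case_prod_unfold)
  also have "\<dots> = ?S - 2 * int ((2 ^ n - 1) div 2)"
    using assms(1) by (simp add: net_cost_concat_columns)
  also have "int ((2 ^ n - 1) div 2) = 2 ^ (n - 1) - 1"
  proof -
    obtain k where "n = Suc k"
      using assms(1) by (cases n) auto
    moreover have "(2 * 2 ^ k - 1) div 2 = (2 ^ k - 1 :: nat)"
      by (cases "2 ^ k :: nat") auto
    ultimately show ?thesis
      by (simp add: of_nat_diff)
  qed
  \<comment> \<open>Subtracting \<open>3 * 2 * (2 ^ (n - 1) - 1)\<close> turns the coefficient -15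
    into -21 and the constant 4 into 10.\<close>
  finally have "3 * int (length (poa_circuit n V)) = 7 * 2 ^ (2 * n - 1) - 21 * 2 ^ (n - 1) + 10"
    using sum_net_cost_column[OF assms(1)] by simp
  then have "real_of_int (3 * int (length (poa_circuit n V)))
      = real_of_int (7 * 2 ^ (2 * n - 1) - 21 * 2 ^ (n - 1) + 10)"
    by (rule arg_cong)
  then show ?thesis
    by simp
qed

end
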